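(* Let $\tau_1,\tau_2,\tilde\tau_1,\tilde\tau_2\in L_2(0,1)$ be complex-valued functions, let $\mathcal L$ and $\tilde{\mathcal L}$ be the problems associated with $(\tau_1,\tau_2)$ and $(\tilde\tau_1,\tilde\tau_2)$, respectively, and assume $\mathcal L,\tilde{\mathcal L}\in\mathcal W$. If $\tau_1=\tilde\tau_1$ and $\tau_2(x)=\tilde\tau_2(x)+cx$ a.e. on $(0,1)$, where $c\in\mathbb C$ is an arbitrary constant, then $\mathfrak S_{12}=\tilde{\mathfrak S}_{12}$, $\mathfrak S_{13}=\tilde{\mathfrak S}_{13}$, $\mathfrak S_{23}=\tilde{\mathfrak S}_{23}$ (spectra counted with multiplicities).
   Context: The formal differential expression is $l(y)=y^{(4)}-(py')'+qy$ on $(0,1)$ with $p\in W_2^{-1}(0,1)$, $q\in W_2^{-2}(0,1)$. It is regularized as follows. For complex-valued $\tau_1,\tau_2\in L_2(0,1)$ with $\tau_1'=p$, $\tau_2''=q$ in the sense of distributions, let $$F(x)=[f_{k,j}(x)]_{k,j=1}^4=\begin{pmatrix} 0 & 1 & 0 & 0 \\ -\tau_2 & \tau_1 & 1 & 0 \\ \tau_1\tau_2 & -\tau_1^2+2\tau_2 & -\tau_1 & 1 \\ \tau_2^2 & -\tau_1\tau_2 & -\tau_2 & 0 \end{pmatrix}.$$ Quasi-derivatives: $y^{[0]}=y$, $y^{[k]}=(y^{[k-1]})'-\sum_{j=1}^{k}f_{k,j}y^{[j-1]}$ for $k=1,\dots,4$. Domain: $\mathcal D_F=\{y: y^{[k]}\in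 AC[0,1],\ k=0,1,2,3\}$. For $\lambda\in\mathbb C$, a solution of the equation $l(y)=\lambda y$ means a function $y\in\mathcal D_F$ with $y^{[4]}=\lambda y$ a.e. on $(0,1)$. Linear forms: $U_s(y)=y^{[s-1]}(0)$ for $s=1,2,3,4$, and $V_1(y)=y^{[3]}(1)$, $V_2(y)=y^{[1]}(1)$, $V_3(y)=y^{[2]}(1)$, $V_4(y)=y(1)$. The problem $\mathcal L$ consists of $F$ together with these linear forms. Let $C_k(x,\lambda)$, $k=1,\dots,4$, be the solutions of $l(y)=\lambda y$ with $U_s(C_k)=\delta_{s,k}$, $s=1,\dots,4$. For $k=1,2,3$ put $\Delta_{kk}(\lambda)=\det[V_s(C_r)]_{s,r=k+1}^4$; these are entire functions of $\lambda$. One says $\mathcal L\in\mathcal W$ if all zeros of $\Delta_{kk}$ are simple for $k=1,2,3$, and $\Delta_{kk}$ and $\Delta_{k+1,k+1}$ have no common zeros for $k=1,2$. For $(i,j)\in\{(1,2),(1,3),(2,3)\}$, $\mathfrak S_{ij}$ is the spectrum (collection of eigenvalues) of the boundary value problem $l(y)=\lambda y$, $U_i(y)=U_j(y)=0$, $V_3(y)=V_4(y)=0$, each eigenvalue being counted with its multiplicity as a zero of the entire function $\det\begin{pmatrix} V_3(C_a) & V_3(C_b) \\ V_4(C_a) & V_4(C_b) \end{pmatrix}$, where $\{a,b\}=\{1,2,3,4\}\setminus\{i,j\}$. Objects with a tilde are defined in the same way from $(\tilde\tau_1,\tilde\tau_2)$, with linear forms of the same shape built from the quasi-derivatives generated by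 $\tilde F$. *)

theory Defs
  imports "HOL-Complex_Analysis.Complex_Analysis" "Jordan_Normal_Form.Determinant"
begin

definition square_integrable :: "(real \<Rightarrow> complex) \<Rightarrow> bool" where
  "square_integrable f \<longleftrightarrow>
     f \<in> borel_measurable (lebesgue_on {0<..<1}) \<and>
     integrable (lebesgue_on {0<..<1}) (\<lambda>x. (cmod (f x))\<^sup>2)"

text \<open>Absolute continuity on \<open>[0,1]\<close> (not the library's \<open>absolutely_continuous\<close>, which is
  about measures). A division consists of finitely many nonoverlapping compact intervals
  \<open>k = [Inf k, Sup k]\<close>.\<close>
definition abs_continuous_01 :: "(real \<Rightarrow> complex) \<Rightarrow> bool" where
  "abs_continuous_01 f \<longleftrightarrow>
     (\<forall>\<epsilon>>0. \<exists>\<delta>>0. \<forall>d. d division_of \<Union>d \<and> \<Union>d \<subseteq> {0..1} \<and> (\<Sum>k\<in>d. Sup k - Inf k) < \<delta>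
        \<longrightarrow> (\<Sum>k\<in>d. cmod (f (Sup k) - f (Inf k))) < \<epsilon>)"

definition F_matrix :: "(real \<Rightarrow> complex) \<Rightarrow> (real \<Rightarrow> complex) \<Rightarrow> real \<Rightarrow> complex Matrix.mat" where
  "F_matrix \<tau>1 \<tau>2 x = mat_of_rows_list 4
     [[0,              1,                         0,        0],
      [- \<tau>2 x,         \<tau>1 x,                      1,        0],
      [\<tau>1 x * \<tau>2 x,    - (\<tau>1 x)\<^sup>2 + 2 * \<tau>2 x,   - \<tau>1 x,   1],
      [(\<tau>2 x)\<^sup>2,       - (\<tau>1 x * \<tau>2 x),          - \<tau>2 x,   0]]"

text \<open>\<open>Y k\<close> is the quasi-derivative \<open>y\<^bsup>[k]\<^esup>\<close>. It is only determined almost everywhere by its defining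
  formula; for \<open>k \<le> 3\<close> the relation selects its absolutely continuous representative, which is
  what gives the values at \<open>0\<close> and \<open>1\<close> a meaning. Matrix indices are shifted because the
  library's matrices are indexed from 0.\<close>
definition quasi_derivatives ::
  "(real \<Rightarrow> complex Matrix.mat) \<Rightarrow> (real \<Rightarrow> complex) \<Rightarrow> (nat \<Rightarrow> real \<Rightarrow> complex) \<Rightarrow> bool" where
  "quasi_derivatives F y Y \<longleftrightarrow>
     Y 0 = y \<and>
     (\<forall>k\<in>{0..3}. abs_continuous_01 (Y k)) \<and>
     (\<forall>k\<in>{1..4}. AE x in lebesgue_on {0<..<1}.
        Y (k - 1) differentiable (at x) \<and>
        Y k x = vector_derivative (Y (k - 1)) (at x)
                - (\<Sum>j=1..k. F x $$ (k - 1, j - 1) * Y (j - 1) x))"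

definition dom_F :: "(real \<Rightarrow> complex Matrix.mat) \<Rightarrow> (real \<Rightarrow> complex) set" where
  "dom_F F = {y. \<exists>Y. quasi_derivatives F y Y}"

text \<open>Meaningful for \<open>y \<in> dom_F F\<close> only. The choice is unique on \<open>[0,1]\<close> for \<open>k \<le> 3\<close> and
  unique almost everywhere on \<open>(0,1)\<close> for \<open>k = 4\<close>.\<close>
definition quasi_deriv ::
  "(real \<Rightarrow> complex Matrix.mat) \<Rightarrow> (real \<Rightarrow> complex) \<Rightarrow> nat \<Rightarrow> real \<Rightarrow> complex" where
  "quasi_deriv F y = (SOME Y. quasi_derivatives F y Y)"

definition is_solution ::
  "(real \<Rightarrow> complex Matrix.mat) \<Rightarrow> complex \<Rightarrow> (real \<Rightarrow> complex) \<Rightarrow> bool" where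
  "is_solution F lam y \<longleftrightarrow>
     y \<in> dom_F F \<and> (AE x in lebesgue_on {0<..<1}. quasi_deriv F y 4 x = lam * y x)"

definition U_form :: "(real \<Rightarrow> complex Matrix.mat) \<Rightarrow> nat \<Rightarrow> (real \<Rightarrow> complex) \<Rightarrow> complex" where
  "U_form F s y = quasi_deriv F y (s - 1) 0"

definition V_form :: "(real \<Rightarrow> complex Matrix.mat) \<Rightarrow> nat \<Rightarrow> (real \<Rightarrow> complex) \<Rightarrow> complex" where
  "V_form F s y = quasi_deriv F y ([3, 1, 2, 0] ! (s - 1)) 1"

text \<open>\<open>C k lam\<close> is the function \<open>x \<mapsto> C\<^sub>k(x,lam)\<close>. On \<open>[0,1]\<close> such a family exists and is unique.\<close>
definition cauchy_solutions ::
  "(real \<Rightarrow> complex Matrix.mat) \<Rightarrow> (nat \<Rightarrow> complex \<Rightarrow> real \<Rightarrow> complex) \<Rightarrow> bool" where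
  "cauchy_solutions F C \<longleftrightarrow>
     (\<forall>k\<in>{1..4}. \<forall>lam. is_solution F lam (C k lam) \<and>
        (\<forall>s\<in>{1..4}. U_form F s (C k lam) = (if s = k then 1 else 0)))"

text \<open>\<open>det [V\<^sub>s(C\<^sub>r)]\<close> with \<open>s\<close> running through the list \<open>ss\<close> and \<open>r\<close> through \<open>rs\<close>
  (lists of equal length).\<close>
definition V_det ::
  "(real \<Rightarrow> complex Matrix.mat) \<Rightarrow> (nat \<Rightarrow> complex \<Rightarrow> real \<Rightarrow> complex) \<Rightarrow> nat list \<Rightarrow> nat list \<Rightarrow> complex \<Rightarrow> complex" where
  "V_det F C ss rs lam =
     Determinant.det (Matrix.mat (length ss) (length rs) (\<lambda>(m, n). V_form F (ss ! m) (C (rs ! n) lam)))"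

definition Delta ::
  "(real \<Rightarrow> complex Matrix.mat) \<Rightarrow> (nat \<Rightarrow> complex \<Rightarrow> real \<Rightarrow> complex) \<Rightarrow> nat \<Rightarrow> complex \<Rightarrow> complex" where
  "Delta F C k = V_det F C [k + 1..<5] [k + 1..<5]"

text \<open>Multiplicity of \<open>z\<close> as a zero of an entire function; \<open>zorder\<close> is unspecified for the
  zero function, which is therefore treated separately.\<close>
definition zero_mult :: "(complex \<Rightarrow> complex) \<Rightarrow> complex \<Rightarrow> enat" where
  "zero_mult f z = (if \<forall>w. f w = 0 then \<infinity> else enat (nat (zorder f z)))"

definition class_W ::
  "(real \<Rightarrow> complex Matrix.mat) \<Rightarrow> (nat \<Rightarrow> complex \<Rightarrow> real \<Rightarrow> complex) \<Rightarrow> bool" where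
  "class_W F C \<longleftrightarrow>
     (\<forall>k\<in>{1..3}. \<forall>lam. Delta F C k lam = 0 \<longrightarrow> zero_mult (Delta F C k) lam = 1) \<and>
     (\<forall>k\<in>{1..2}. \<nexists>lam. Delta F C k lam = 0 \<and> Delta F C (k + 1) lam = 0)"

definition is_eigenvalue :: "(real \<Rightarrow> complex Matrix.mat) \<Rightarrow> nat \<Rightarrow> nat \<Rightarrow> complex \<Rightarrow> bool" where
  "is_eigenvalue F i j lam \<longleftrightarrow>
     (\<exists>y. is_solution F lam y \<and> (\<exists>x\<in>{0..1}. y x \<noteq> 0) \<and>
          U_form F i y = 0 \<and> U_form F j y = 0 \<and> V_form F 3 y = 0 \<and> V_form F 4 y = 0)"

text \<open>Each eigenvalue is paired with its multiplicity.\<close>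
definition spectrum_S ::
  "(real \<Rightarrow> complex Matrix.mat) \<Rightarrow> (nat \<Rightarrow> complex \<Rightarrow> real \<Rightarrow> complex) \<Rightarrow> nat \<Rightarrow> nat \<Rightarrow> (complex \<times> enat) set" where
  "spectrum_S F C i j =
     {(lam, zero_mult (V_det F C [3, 4] (sorted_list_of_set ({1, 2, 3, 4} - {i, j}))) lam) | lam.
        is_eigenvalue F i j lam}"

end

theory Submission
  imports Defs
begin

text \<open>
  Formally \<open>l(y)\<close> depends on \<open>\<tau>2\<close> only through its second derivative, so adding \<open>c x\<close> to \<open>\<tau>2\<close> should
  leave the equation unchanged; only the quasi-derivatives, and with them the linear forms, change.
  Computing them from the recursion gives, with a prime on the bracket for the problem of \<open>F'\<close>,
  \<open>y\<^bsup>[0]\<^esup> = y\<^bsup>[0]'\<^esup>\<close>, \<open>y\<^bsup>[1]\<^esup> = y\<^bsup>[1]'\<^esup>\<close>, \<open>y\<^bsup>[2]\<^esup> = y\<^bsup>[2]'\<^esup> + c x y\<close>,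
  \<open>y\<^bsup>[3]\<^esup> = y\<^bsup>[3]'\<^esup> + c y - c x y\<^bsup>[1]'\<^esup>\<close> and \<open>y\<^bsup>[4]\<^esup> = y\<^bsup>[4]'\<^esup>\<close> (lemma \<open>quasi_derivatives_shift\<close>).
  The two equations therefore have the same solutions. At the end points the forms are related by
  \<open>U\<^sub>s = U'\<^sub>s\<close> for \<open>s \<le> 3\<close>, \<open>U\<^sub>4 = U'\<^sub>4 + c U'\<^sub>1\<close>, \<open>V\<^sub>4 = V'\<^sub>4\<close> and \<open>V\<^sub>3 = V'\<^sub>3 + c V'\<^sub>4\<close>.

  Consequently the boundary conditions that define the three spectra are equivalent for the two
  problems, and the eigenvalues agree. For the multiplicities, the initial data show that
  \<open>C\<^sub>k = C'\<^sub>k\<close> for \<open>k \<ge> 2\<close> and \<open>C\<^sub>1 = C'\<^sub>1 - c C'\<^sub>4\<close>. Since \<open>4\<close> is one of the two column indices of each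
  characteristic determinant, the passage from one problem to the other consists of a row and a
  column operation, and the determinants are equal as functions (lemma \<open>V_det_shift\<close>).

  The analytic ingredient is uniqueness for the initial value problem, which identifies the
  families \<open>C\<close> and \<open>C'\<close> on \<open>[0,1]\<close>. The quasi-derivatives solve a first-order linear system with
  integrable coefficients, almost everywhere, and are absolutely continuous. Uniqueness is the usual
  contraction argument on short intervals (lemma \<open>linear_system_unique\<close>); it rests on the fundamental
  theorem of calculus for absolutely continuous functions.
\<close>

section \<open>Absolutely continuous functions on the unit interval\<close>

lemma division_of_unit_interval_memberE:
  fixes d :: "real set set"
  assumes "d division_of \<Union>d" "\<Union>d \<subseteq> {0..1}" "k \<in> d"
  obtains u v where "k = {u..v}" "Inf k = u" "Sup k = v" "0 \<le> u" "u \<le> v" "v \<le> 1"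
proof -
  obtain u v where k: "k = cbox u v" using division_ofD(4)[OF assms(1,3)] by blast
  have "k \<noteq> {}" using division_ofD(3)[OF assms(1,3)] .
  hence uv: "u \<le> v" using k by simp
  have "k \<subseteq> {0..1}" using assms(2,3) by blast
  hence "0 \<le> u" "v \<le> 1" using uv k by auto
  thus ?thesis using that[of u v] k uv by simp
qed

text \<open>This single estimate yields all closure properties below, since it reduces each of them to a
  bound for the increments of the new function.\<close>
lemma abs_continuous_01_dominated:
  assumes f: "abs_continuous_01 f" and g: "abs_continuous_01 g" and "0 \<le> A" "0 \<le> B"
    and le: "\<And>u v. 0 \<le> u \<Longrightarrow> u \<le> v \<Longrightarrow> v \<le> 1 \<Longrightarrow>
        cmod (h v - h u) \<le> A * cmod (f v - f u) + B * cmod (g v - g u)"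
  shows "abs_continuous_01 h"
  unfolding abs_continuous_01_def
proof (intro allI impI)
  fix e :: real assume "e > 0"
  define e' where "e' = e / (A + B + 1)"
  have "e' > 0" using \<open>e > 0\<close> assms by (simp add: e'_def)
  obtain d1 where d1: "d1 > 0" "\<And>d. d division_of \<Union>d \<and> \<Union>d \<subseteq> {0..1} \<and> (\<Sum>k\<in>d. Sup k - Inf k) < d1
        \<Longrightarrow> (\<Sum>k\<in>d. cmod (f (Sup k) - f (Inf k))) < e'"
    using f \<open>e' > 0\<close> unfolding abs_continuous_01_def by meson
  obtain d2 where d2: "d2 > 0" "\<And>d. d division_of \<Union>d \<and> \<Union>d \<subseteq> {0..1} \<and> (\<Sum>k\<in>d. Sup k - Inf k) < d2
        \<Longrightarrow> (\<Sum>k\<in>d. cmod (g (Sup k) - g (Inf k))) < e'"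
    using g \<open>e' > 0\<close> unfolding abs_continuous_01_def by meson
  show "\<exists>\<delta>>0. \<forall>d. d division_of \<Union>d \<and> \<Union>d \<subseteq> {0..1} \<and> (\<Sum>k\<in>d. Sup k - Inf k) < \<delta>
        \<longrightarrow> (\<Sum>k\<in>d. cmod (h (Sup k) - h (Inf k))) < e"
  proof (intro exI conjI allI impI)
    show "min d1 d2 > 0" using d1 d2 by simp
    fix d assume d: "d division_of \<Union>d \<and> \<Union>d \<subseteq> {0..1} \<and> (\<Sum>k\<in>d. Sup k - Inf k) < min d1 d2"
    have "(\<Sum>k\<in>d. cmod (h (Sup k) - h (Inf k)))
        \<le> (\<Sum>k\<in>d. A * cmod (f (Sup k) - f (Inf k)) + B * cmod (g (Sup k) - g (Inf k)))"
    proof (rule sum_mono)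
      fix k assume "k \<in> d"
      then obtain u v where "k = {u..v}" "Inf k = u" "Sup k = v" "0 \<le> u" "u \<le> v" "v \<le> 1"
        using d by (metis division_of_unit_interval_memberE)
      thus "cmod (h (Sup k) - h (Inf k))
          \<le> A * cmod (f (Sup k) - f (Inf k)) + B * cmod (g (Sup k) - g (Inf k))"
        using le[of u v] by simp
    qed
    also have "\<dots> = A * (\<Sum>k\<in>d. cmod (f (Sup k) - f (Inf k))) + B * (\<Sum>k\<in>d. cmod (g (Sup k) - g (Inf k)))"
      by (simp add: sum.distrib sum_distrib_left)
    also have "\<dots> \<le> A * e' + B * e'"
      using d1(2)[of d] d2(2)[of d] d assms(3,4)
      by (intro add_mono mult_left_mono) (simp_all add: less_imp_le)
    also have "\<dots> = (A + B) * e / (A + B + 1)"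
      by (simp add: e'_def add_divide_distrib distrib_right)
    also have "\<dots> < e" using assms(3,4) \<open>e > 0\<close> by (simp add: field_simps)
    finally show "(\<Sum>k\<in>d. cmod (h (Sup k) - h (Inf k))) < e" .
  qed
qed

lemma abs_continuous_01_linear_combination:
  assumes "abs_continuous_01 f" "abs_continuous_01 g"
  shows "abs_continuous_01 (\<lambda>x. a * f x + b * g x)"
proof (rule abs_continuous_01_dominated[OF assms, where A = "cmod a" and B = "cmod b"])
  fix u v
  have "(a * f v + b * g v) - (a * f u + b * g u) = a * (f v - f u) + b * (g v - g u)"
    by (simp add: algebra_simps)
  thus "cmod ((a * f v + b * g v) - (a * f u + b * g u))
      \<le> cmod a * cmod (f v - f u) + cmod b * cmod (g v - g u)"
    by (metis norm_mult norm_triangle_ineq)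
qed auto

lemma abs_continuous_01_of_real: "abs_continuous_01 of_real"
  unfolding abs_continuous_01_def
proof (intro allI impI)
  fix e :: real assume "e > 0"
  show "\<exists>\<delta>>0. \<forall>d. d division_of \<Union>d \<and> \<Union>d \<subseteq> {0..1} \<and> (\<Sum>k\<in>d. Sup k - Inf k) < \<delta>
        \<longrightarrow> (\<Sum>k\<in>d. cmod (of_real (Sup k) - of_real (Inf k))) < e"
  proof (intro exI conjI allI impI)
    fix d :: "real set set"
    assume d: "d division_of \<Union>d \<and> \<Union>d \<subseteq> {0..1} \<and> (\<Sum>k\<in>d. Sup k - Inf k) < e"
    have "(\<Sum>k\<in>d. cmod (of_real (Sup k) - of_real (Inf k))) = (\<Sum>k\<in>d. Sup k - Inf k)"
    proof (rule sum.cong)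
      fix k assume "k \<in> d"
      then obtain u v where "Inf k = u" "Sup k = v" "u \<le> v"
        using d by (metis division_of_unit_interval_memberE)
      thus "cmod (of_real (Sup k) - of_real (Inf k)) = Sup k - Inf k"
        by (simp flip: of_real_diff)
    qed simp
    thus "(\<Sum>k\<in>d. cmod (of_real (Sup k) - of_real (Inf k))) < e" using d by simp
  qed (fact \<open>e > 0\<close>)
qed

lemma abs_continuous_01_imp_continuous_on:
  assumes "abs_continuous_01 f"
  shows "continuous_on {0..1} f"
  unfolding continuous_on_iff
proof (intro ballI allI impI)
  fix x e :: real assume x: "x \<in> {0..1}" and "e > 0"
  then obtain \<delta> where \<delta>: "\<delta> > 0" "\<And>d. d division_of \<Union>d \<and> \<Union>d \<subseteq> {0..1} \<and> (\<Sum>k\<in>d. Sup k - Inf k) < \<delta>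
        \<Longrightarrow> (\<Sum>k\<in>d. cmod (f (Sup k) - f (Inf k))) < e"
    using assms unfolding abs_continuous_01_def by meson
  have *: "cmod (f v - f u) < e" if "0 \<le> u" "u \<le> v" "v \<le> 1" "v - u < \<delta>" for u v
  proof -
    have "{{u..v}} division_of {u..v}"
      using division_of_self[of u v] that by simp
    thus ?thesis using \<delta>(2)[of "{{u..v}}"] that by simp
  qed
  show "\<exists>d>0. \<forall>x'\<in>{0..1}. dist x' x < d \<longrightarrow> dist (f x') (f x) < e"
  proof (intro exI conjI ballI impI)
    fix x' :: real assume x': "x' \<in> {0..1}" "dist x' x < \<delta>"
    show "dist (f x') (f x) < e"
      using *[of x x'] *[of x' x] x x' by (cases "x \<le> x'") (auto simp: dist_norm dist_real_def norm_minus_commute)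
  qed (fact \<open>\<delta> > 0\<close>)
qed

lemma abs_continuous_01_mult:
  assumes f: "abs_continuous_01 f" and g: "abs_continuous_01 g"
  shows "abs_continuous_01 (\<lambda>x. f x * g x)"
proof -
  have bound: "\<exists>B\<ge>0. \<forall>x\<in>{0..1}. cmod (h x) \<le> B" if "abs_continuous_01 h" for h
  proof -
    have "bounded (h ` {0..1})"
      by (intro compact_imp_bounded compact_continuous_image abs_continuous_01_imp_continuous_on that) simp
    then obtain B where "\<forall>x\<in>{0..1}. cmod (h x) \<le> B" by (auto simp: bounded_iff)
    thus ?thesis by (intro exI[of _ "max B 0"]) auto
  qed
  obtain A where A: "A \<ge> 0" "\<And>x. x \<in> {0..1} \<Longrightarrow> cmod (f x) \<le> A" using bound[OF f] by blast
  obtain B where B: "B \<ge> 0" "\<And>x. x \<in> {0..1} \<Longrightarrow> cmod (g x) \<le> B" using bound[OF g] by blast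
  show ?thesis
  proof (rule abs_continuous_01_dominated[OF f g B(1) A(1)])
    fix u v :: real assume uv: "0 \<le> u" "u \<le> v" "v \<le> 1"
    have "f v * g v - f u * g u = (f v - f u) * g v + f u * (g v - g u)"
      by (simp add: algebra_simps)
    hence "cmod (f v * g v - f u * g u) \<le> cmod (f v - f u) * cmod (g v) + cmod (f u) * cmod (g v - g u)"
      by (metis norm_mult norm_triangle_ineq)
    also have "\<dots> \<le> cmod (f v - f u) * B + A * cmod (g v - g u)"
      using A(2)[of u] B(2)[of v] uv by (intro add_mono mult_left_mono mult_right_mono) auto
    finally show "cmod (f v * g v - f u * g u) \<le> B * cmod (f v - f u) + A * cmod (g v - g u)"
      by (simp add: mult.commute)
  qed
qed

text \<open>The Henstock--Kurzweil integral permits a direct proof, without Vitali coverings or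
  Lebesgue's differentiation theorem. In a fine tagged division of \<open>[a,b]\<close> the increments of \<open>f\<close>
  over intervals tagged outside \<open>N\<close> are approximated by the derivative at the tag. The gauge keeps
  the intervals tagged in \<open>N\<close> inside an open set \<open>T\<close> of small measure, so absolute continuity makes
  the increments over them small.\<close>
lemma abs_continuous_01_fundamental_theorem:
  assumes f: "abs_continuous_01 f" and N: "negligible N" and ab: "0 \<le> a" "a \<le> b" "b \<le> 1"
    and deriv: "\<And>x. x \<in> {a..b} - N \<Longrightarrow> (f has_vector_derivative f' x) (at x)"
  shows "(f' has_integral f b - f a) {a..b}"
proof -
  define g where "g x = (if x \<in> N then 0 else f' x)" for x
  have "(g has_integral f b - f a) (cbox a b)"
    unfolding has_integral
  proof (intro allI impI)
    fix e :: real assume "e > 0"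
    \<comment> \<open>The good intervals have total length at most \<open>b - a\<close>; the \<open>+ 1\<close> covers \<open>a = b\<close> and makes
      the estimate strict.\<close>
    define e1 where "e1 = e / (2 * (b - a + 1))"
    have "e1 > 0" using \<open>e > 0\<close> ab by (simp add: e1_def)
    obtain \<delta> where \<delta>: "\<delta> > 0" "\<And>d. d division_of \<Union>d \<and> \<Union>d \<subseteq> {0..1} \<and> (\<Sum>k\<in>d. Sup k - Inf k) < \<delta>
        \<Longrightarrow> (\<Sum>k\<in>d. cmod (f (Sup k) - f (Inf k))) < e/2"
      using f \<open>e > 0\<close> half_gt_zero unfolding abs_continuous_01_def by meson
    obtain T where T: "open T" "N \<subseteq> T" "T - N \<in> lmeasurable" "emeasure lebesgue (T - N) < ennreal \<delta>"
      using sets_lebesgue_outer_open[OF negligible_imp_sets[OF N] \<delta>(1)] by blast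
    have Tm: "T \<in> lmeasurable"
      using fmeasurable.Un[OF T(3) negligible_imp_measurable[OF N]] T(2) by (simp add: Un_absorb2)
    have "measure lebesgue T = measure lebesgue (T - N)"
      using measure_Diff_null_set[of T lebesgue N] N Tm
      by (simp add: negligible_iff_null_sets fmeasurableD)
    also have "\<dots> < \<delta>"
      using T(3,4) \<delta>(1) by (simp add: emeasure_eq_measure2 ennreal_less_iff)
    finally have Tless: "measure lebesgue T < \<delta>" .
    have "\<forall>x. \<exists>d>0. (x \<in> {a..b} - N \<longrightarrow>
         (\<forall>y. norm (y - x) < d \<longrightarrow> cmod (f y - f x - (y - x) *\<^sub>R f' x) \<le> e1 * norm (y - x))) \<and>
         (x \<in> N \<longrightarrow> ball x d \<subseteq> T)"
    proof
      fix x
      have one01: "0 < (1::real)" by simp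
      have A: "\<exists>d>0. (x \<in> {a..b} - N \<longrightarrow>
         (\<forall>y. norm (y - x) < d \<longrightarrow> cmod (f y - f x - (y - x) *\<^sub>R f' x) \<le> e1 * norm (y - x)))"
        using deriv[of x] \<open>e1 > 0\<close> one01
        unfolding has_vector_derivative_def has_derivative_at_alt by blast
      have B: "\<exists>d>0. x \<in> N \<longrightarrow> ball x d \<subseteq> T"
        using T(1,2) open_contains_ball one01 by blast
      show "\<exists>d>0. (x \<in> {a..b} - N \<longrightarrow>
         (\<forall>y. norm (y - x) < d \<longrightarrow> cmod (f y - f x - (y - x) *\<^sub>R f' x) \<le> e1 * norm (y - x))) \<and>
         (x \<in> N \<longrightarrow> ball x d \<subseteq> T)"
        using A B by (cases "x \<in> N") auto
    qed
    then obtain d where d: "\<And>x. d x > 0"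
      "\<And>x y. x \<in> {a..b} - N \<Longrightarrow> norm (y - x) < d x
          \<Longrightarrow> cmod (f y - f x - (y - x) *\<^sub>R f' x) \<le> e1 * norm (y - x)"
      "\<And>x. x \<in> N \<Longrightarrow> ball x (d x) \<subseteq> T" by metis
    show "\<exists>\<gamma>. gauge \<gamma> \<and> (\<forall>\<D>. \<D> tagged_division_of cbox a b \<and> \<gamma> fine \<D> \<longrightarrow>
        norm ((\<Sum>(x, k)\<in>\<D>. measure lborel k *\<^sub>R g x) - (f b - f a)) < e)"
    proof (intro exI conjI allI impI; (elim conjE)?)
      show "gauge (\<lambda>x. ball x (d x))" using d(1) by (rule gauge_ball_dependent[rule_format])
      fix p assume p: "p tagged_division_of cbox a b" and fine: "(\<lambda>x. ball x (d x)) fine p"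
      have member: "\<exists>u v. k = {u..v} \<and> u \<le> x \<and> x \<le> v \<and> a \<le> u \<and> v \<le> b \<and> Inf k = u \<and> Sup k = v
          \<and> measure lborel k = v - u \<and> {u..v} \<subseteq> ball x (d x)" if xk: "(x, k) \<in> p" for x k
      proof -
        obtain u v where k: "k = cbox u v" using tagged_division_ofD(4)[OF p xk] by blast
        have "x \<in> k" "k \<subseteq> cbox a b" using tagged_division_ofD(2,3)[OF p xk] by auto
        moreover have "k \<subseteq> ball x (d x)" using fine xk by (auto simp: fine_def)
        ultimately show ?thesis using k by (intro exI[of _ u] exI[of _ v]) auto
      qed
      have fin: "finite p" using tagged_division_of_finite[OF p] .
      define q where "q = {z \<in> p. fst z \<in> N}"
      have qp: "q \<subseteq> p" "finite q" "finite (p - q)" using fin by (auto simp: q_def)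
      define D where "D = (\<lambda>(x, k::real set). measure lborel k *\<^sub>R g x - (f (Sup k) - f (Inf k)))"
      have "(\<Sum>(x, k)\<in>p. measure lborel k *\<^sub>R g x) - (f b - f a) = sum D p"
        using additive_tagged_division_1[OF ab(2), of p f] p
        by (simp add: D_def sum_subtractf case_prod_unfold)
      also have "\<dots> = sum D (p - q) + sum D q"
        using sum.subset_diff[OF qp(1) fin] .
      finally have eq: "(\<Sum>(x, k)\<in>p. measure lborel k *\<^sub>R g x) - (f b - f a) = sum D (p - q) + sum D q" .
      have "cmod (sum D (p - q)) \<le> (\<Sum>(x, k)\<in>p - q. e1 * (Sup k - Inf k))"
      proof (rule sum_norm_le, clarify)
        fix x k assume xk: "(x, k) \<in> p" "(x, k) \<notin> q"
        hence "x \<notin> N" by (simp add: q_def)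
        obtain u v where uv: "k = {u..v}" "u \<le> x" "x \<le> v" "a \<le> u" "v \<le> b" "Inf k = u" "Sup k = v"
          "measure lborel k = v - u" "{u..v} \<subseteq> ball x (d x)" using member[OF xk(1)] by blast
        have "u \<in> ball x (d x)" "v \<in> ball x (d x)"
          using uv(2,3) by (intro subsetD[OF uv(9)]; simp)+
        hence near: "norm (u - x) < d x" "norm (v - x) < d x" by (auto simp: dist_real_def)
        have xab: "x \<in> {a..b} - N" using uv \<open>x \<notin> N\<close> by auto
        have "D (x, k) = (f u - f x - (u - x) *\<^sub>R f' x) - (f v - f x - (v - x) *\<^sub>R f' x)"
          using \<open>x \<notin> N\<close> uv by (simp add: D_def g_def algebra_simps scaleR_left_diff_distrib)
        hence "cmod (D (x, k)) \<le> e1 * norm (u - x) + e1 * norm (v - x)"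
          using d(2)[OF xab near(1)] d(2)[OF xab near(2)] norm_triangle_ineq4 by (smt (verit))
        also have "\<dots> = e1 * (Sup k - Inf k)" using uv by (simp add: algebra_simps)
        finally show "cmod (D (x, k)) \<le> e1 * (Sup k - Inf k)" .
      qed
      also have "\<dots> \<le> (\<Sum>(x, k)\<in>p. e1 * (Sup k - Inf k))"
      proof (rule sum_mono2[OF fin])
        fix z assume "z \<in> p - (p - q)"
        then show "0 \<le> (case z of (x, k) \<Rightarrow> e1 * (Sup k - Inf k))"
          using member[of "fst z" "snd z"] \<open>e1 > 0\<close> by (auto simp: case_prod_unfold)
      qed auto
      also have "\<dots> = e1 * (b - a)"
        using additive_tagged_division_1[OF ab(2), of p "\<lambda>x. x"] p
        by (simp add: case_prod_unfold flip: sum_distrib_left)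
      also have "\<dots> < e / 2"
        using \<open>e > 0\<close> ab by (simp add: e1_def field_simps)
      finally have good: "cmod (sum D (p - q)) < e / 2" .
      have qt: "q tagged_division_of (\<Union>(snd ` q))"
        using tagged_partial_division_of_Union_self tagged_partial_division_subset qp(1)
          tagged_division_of_def p by metis
      have qd: "snd ` q division_of (\<Union>(snd ` q))" using division_of_tagged_division[OF qt] .
      have "cmod (sum D q) \<le> (\<Sum>(x, k)\<in>q. cmod (f (Sup k) - f (Inf k)))"
        by (rule sum_norm_le) (auto simp: D_def g_def q_def norm_minus_commute)
      also have "\<dots> = (\<Sum>k\<in>snd ` q. cmod (f (Sup k) - f (Inf k)))"
      proof -
        \<comment> \<open>\<open>Inf {}\<close> and \<open>Sup {}\<close> are unspecified reals, so \<open>over_tagged_division_lemma\<close> applies only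
          after the summand is set to zero at the empty set, which does not occur here.\<close>
        let ?i = "\<lambda>k. if k = {} then 0 else cmod (f (Sup k) - f (Inf k))"
        have ne: "k \<noteq> {}" if "(x, k) \<in> q" for x k
          using tagged_division_ofD(2)[OF p, of x k] that qp(1) by auto
        have "(\<Sum>(x, k)\<in>q. cmod (f (Sup k) - f (Inf k))) = (\<Sum>(x, k)\<in>q. ?i k)"
          by (rule sum.cong) (auto dest: ne)
        also have "\<dots> = (\<Sum>k\<in>snd ` q. ?i k)"
          by (rule sum.over_tagged_division_lemma[OF qt]) (auto simp: box_eq_empty)
        also have "\<dots> = (\<Sum>k\<in>snd ` q. cmod (f (Sup k) - f (Inf k)))"
          by (rule sum.cong) (auto dest: ne)
        finally show ?thesis .
      qed
      also have "\<dots> < e / 2"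
      proof (rule \<delta>(2), intro conjI)
        have qmem: "k \<subseteq> {0..1} \<and> k \<subseteq> T \<and> measure lebesgue k = Sup k - Inf k" if "k \<in> snd ` q" for k
        proof -
          obtain z where "z \<in> q" "k = snd z" using \<open>k \<in> snd ` q\<close> by blast
          then obtain x where xk: "(x, k) \<in> p" "x \<in> N" by (cases z) (auto simp: q_def)
          obtain u v where uv: "k = {u..v}" "u \<le> x" "x \<le> v" "a \<le> u" "v \<le> b" "Inf k = u" "Sup k = v"
            "measure lborel k = v - u" "{u..v} \<subseteq> ball x (d x)" using member[OF xk(1)] by blast
          have "{u..v} \<subseteq> {0..1}" using uv(4,5) ab by simp
          moreover have "{u..v} \<subseteq> T" using uv(9) d(3)[OF xk(2)] by (rule subset_trans)
          moreover have "measure lebesgue {u..v} = v - u" using uv(2,3) by simp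
          ultimately show ?thesis unfolding uv(6,7) unfolding uv(1) by blast
        qed
        show "snd ` q division_of \<Union>(snd ` q)" by (fact qd)
        show "\<Union>(snd ` q) \<subseteq> {0..1}" using qmem by blast
        have "(\<Sum>k\<in>snd ` q. Sup k - Inf k) = sum (measure lebesgue) (snd ` q)"
          using qmem by simp
        also have "\<dots> = measure lebesgue (\<Union>(snd ` q))" by (rule content_division[OF qd])
        also have "\<dots> \<le> measure lebesgue T"
        proof (rule measure_mono_fmeasurable[OF _ _ Tm])
          show "\<Union>(snd ` q) \<subseteq> T" using qmem by blast
          show "\<Union>(snd ` q) \<in> sets lebesgue"
            using lmeasurable_division[OF qd] by (rule fmeasurableD)
        qed
        also have "\<dots> < \<delta>" by (fact Tless)
        finally show "(\<Sum>k\<in>snd ` q. Sup k - Inf k) < \<delta>" .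
      qed
      finally have bad: "cmod (sum D q) < e / 2" .
      show "norm ((\<Sum>(x, k)\<in>p. measure lborel k *\<^sub>R g x) - (f b - f a)) < e"
        unfolding eq using good bad norm_triangle_ineq[of "sum D (p - q)" "sum D q"] by linarith
    qed
  qed
  hence "(g has_integral f b - f a) {a..b}" by simp
  from has_integral_spike[OF N _ this] show ?thesis by (auto simp: g_def)
qed

text \<open>The null set absorbs the endpoints, so that the property is available on the closed interval.\<close>
lemma AE_unit_interval_imp_negligible:
  assumes "AE x in lebesgue_on {0<..<1::real}. P x"
  obtains N where "negligible N" "\<And>x. x \<in> {0..1} - N \<Longrightarrow> P x"
proof -
  obtain N where N: "N \<in> null_sets (lebesgue_on {0<..<1::real})"
      "{x \<in> space (lebesgue_on {0<..<1}). \<not> P x} \<subseteq> N"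
    using assms unfolding eventually_ae_filter by blast
  hence "negligible N" by (simp add: negligible_iff_null_sets null_sets_restrict_space)
  hence "negligible (N \<union> {0, 1})" by simp
  moreover have "P x" if "x \<in> {0..1} - (N \<union> {0, 1})" for x
  proof -
    have "0 < x" "x < 1" using that by auto
    thus "P x" using N(2) that by auto
  qed
  ultimately show ?thesis using that by blast
qed

text \<open>The set where \<open>f\<close> does not vanish is open in \<open>(0,1)\<close> and null, hence empty; the endpoints follow
  by continuity.\<close>
lemma continuous_AE_zero:
  fixes f :: "real \<Rightarrow> complex"
  assumes f: "continuous_on {0..1} f" and ae: "AE x in lebesgue_on {0<..<1}. f x = 0" and x: "x \<in> {0..1}"
  shows "f x = 0"
proof -
  define U where "U = {0<..<1} \<inter> f -` (- {0})"
  have "open U"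
    unfolding U_def by (intro continuous_open_preimage continuous_on_subset[OF f]) auto
  obtain N where N: "negligible N" "\<And>x. x \<in> {0..1} - N \<Longrightarrow> f x = 0"
    using AE_unit_interval_imp_negligible[OF ae] by blast
  have "U \<subseteq> N" using N(2) by (auto simp: U_def)
  hence "U = {}" using N(1) open_not_negligible[OF \<open>open U\<close>] negligible_subset by blast
  hence "\<And>x. x \<in> {0<..<1} \<Longrightarrow> f x = 0" by (auto simp: U_def)
  moreover have "closure {0<..<1} = {0..1::real}" by simp
  ultimately show ?thesis
    using continuous_constant_on_closure[of "{0<..<1}" f 0 x] f x by auto
qed

section \<open>Uniqueness for linear systems with integrable coefficients\<close>

text \<open>Let \<open>S\<close> be the sum of the moduli. On a subinterval where the integral of \<open>h\<close> is less than
  \<open>1/n\<close>, with \<open>n\<close> the number of components, integrating the derivative bound shows that the maximum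
  of \<open>S\<close> is at most a factor less than one times itself, once \<open>S\<close> vanishes at the left end; hence \<open>S\<close>
  vanishes throughout. The indefinite integral of \<open>h\<close> is uniformly continuous, so finitely many such
  subintervals of equal length cover \<open>[0,1]\<close>.\<close>
lemma linear_system_unique:
  fixes Y Y' :: "'k \<Rightarrow> real \<Rightarrow> complex"
  assumes K: "finite K" and ac: "\<And>k. k \<in> K \<Longrightarrow> abs_continuous_01 (Y k)"
    and h: "h integrable_on {0..1}" "\<And>x. 0 \<le> h x"
    and ae: "AE x in lebesgue_on {0<..<1}. \<forall>k\<in>K. (Y k has_vector_derivative Y' k x) (at x) \<and>
        cmod (Y' k x) \<le> h x * (\<Sum>j\<in>K. cmod (Y j x))"
    and init: "\<And>k. k \<in> K \<Longrightarrow> Y k 0 = 0"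
    and kx: "k \<in> K" "x \<in> {0..1}"
  shows "Y k x = 0"
proof -
  define S where "S x = (\<Sum>j\<in>K. cmod (Y j x))" for x
  define H where "H x = integral {0..x} h" for x
  define n where "n = real (card K)"
  have S0: "S x = 0 \<longleftrightarrow> (\<forall>k\<in>K. Y k x = 0)" for x
    using K by (simp add: S_def sum_nonneg_eq_0_iff)
  have Snn: "0 \<le> S x" for x by (simp add: S_def sum_nonneg)
  have Scont: "continuous_on {0..1} S"
    unfolding S_def by (intro continuous_intros abs_continuous_01_imp_continuous_on ac)
  obtain N where N: "negligible N" "\<And>x k. x \<in> {0..1} - N \<Longrightarrow> k \<in> K \<Longrightarrow>
      (Y k has_vector_derivative Y' k x) (at x) \<and> cmod (Y' k x) \<le> h x * S x"
    using AE_unit_interval_imp_negligible[OF ae] unfolding S_def by metis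
  have h_sub: "h integrable_on {s..t}" if "0 \<le> s" "t \<le> 1" for s t
    using integrable_on_subinterval[OF h(1), of s t] that by auto
  \<comment> \<open>vanishing propagates across one short subinterval\<close>
  have step: "S t = 0" if st: "0 \<le> s" "s \<le> t" "t \<le> 1" and "S s = 0" and small: "n * integral {s..t} h < 1" for s t
  proof -
    obtain m where m: "m \<in> {s..t}" "\<And>x. x \<in> {s..t} \<Longrightarrow> S x \<le> S m"
      using continuous_attains_sup[of "{s..t}" S] continuous_on_subset[OF Scont, of "{s..t}"] st by auto
    \<comment> \<open>The increment from \<open>s\<close> to the maximum point \<open>m\<close>; the derivative is set to zero on the null set
      so that it is dominated everywhere.\<close>
    have "cmod (Y k m) \<le> S m * integral {s..t} h" if k: "k \<in> K" for k
    proof -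
      define g where "g x = (if x \<in> N then 0 else Y' k x)" for x
      have "(g has_integral Y k m - Y k s) {s..m}"
      proof (rule abs_continuous_01_fundamental_theorem[OF ac[OF k] N(1)])
        fix x assume "x \<in> {s..m} - N"
        thus "(Y k has_vector_derivative g x) (at x)" using N(2)[of x k] k m(1) st by (auto simp: g_def)
      qed (use m(1) st in auto)
      hence "(g has_integral Y k m) {s..m}" using \<open>S s = 0\<close> k S0 by simp
      hence g: "g integrable_on {s..m}" "integral {s..m} g = Y k m"
        by (simp_all add: has_integral_integrable_integral)
      have "cmod (integral {s..m} g) \<le> integral {s..m} (\<lambda>x. S m * h x)"
      proof (rule integral_norm_bound_integral[OF g(1)])
        show "(\<lambda>x. S m * h x) integrable_on {s..m}"
          using h_sub[of s m] m(1) st by (intro integrable_on_mult_right) auto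
        fix x assume x: "x \<in> {s..m}"
        have "h x * S x \<le> h x * S m" using m x by (intro mult_left_mono h) auto
        thus "cmod (g x) \<le> S m * h x"
          using N(2)[of x k] k x m(1) st h(2)[of x] Snn[of m] by (auto simp: g_def mult.commute)
      qed
      also have "\<dots> = S m * integral {s..m} h" by simp
      also have "\<dots> \<le> S m * integral {s..t} h"
        using m(1) st h(2) by (intro mult_left_mono[OF integral_subset_le Snn] h_sub) auto
      finally show ?thesis using g(2) by simp
    qed
    hence "S m \<le> n * (S m * integral {s..t} h)"
      unfolding S_def[of m] n_def using sum_bounded_above[of K "\<lambda>k. cmod (Y k m)"]
      unfolding S_def[of m] by blast
    hence "S m * (1 - n * integral {s..t} h) \<le> 0" by (simp add: algebra_simps)
    hence "S m \<le> 0" using small by (simp add: mult_le_0_iff)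
    thus ?thesis using m(2)[of t] st Snn[of t] by auto
  qed
  have "continuous_on {0..1} H" unfolding H_def by (rule indefinite_integral_continuous_1[OF h(1)])
  hence "uniformly_continuous_on {0..1} H" by (rule compact_uniformly_continuous) simp
  moreover have n_pos: "1 / (n + 1) > 0" by (simp add: n_def add_nonneg_pos)
  ultimately obtain \<delta> where \<delta>: "\<delta> > 0" "\<And>u v. u \<in> {0..1} \<Longrightarrow> v \<in> {0..1} \<Longrightarrow> dist v u < \<delta> \<Longrightarrow> dist (H v) (H u) < 1 / (n + 1)"
    unfolding uniformly_continuous_on_def
    using n_pos by blast
  have short: "n * integral {s..t} h < 1" if "0 \<le> s" "s \<le> t" "t \<le> 1" "t - s < \<delta>" for s t
  proof -
    have "integral {s..t} h = H t - H s"
      using Henstock_Kurzweil_Integration.integral_combine[of 0 s t h] that h_sub[of 0 t] by (simp add: H_def)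
    also have "\<dots> \<le> 1 / (n + 1)" using \<delta>(2)[of s t] that by (auto simp: dist_real_def)
    finally have "n * integral {s..t} h \<le> n * (1 / (n + 1))" by (rule mult_left_mono) (simp add: n_def)
    also have "\<dots> < 1" by (simp add: n_def field_simps)
    finally show ?thesis .
  qed
  have "\<forall>x\<in>{0..1}. x \<le> real i * (\<delta> / 2) \<longrightarrow> S x = 0" for i
  proof (induction i)
    case 0
    show ?case using S0 init by auto
  next
    case (Suc i)
    show ?case
    proof (intro ballI impI)
      fix x :: real assume x: "x \<in> {0..1}" "x \<le> real (Suc i) * (\<delta> / 2)"
      show "S x = 0"
      proof (cases "x \<le> real i * (\<delta> / 2)")
        case True thus ?thesis using Suc x by blast
      next
        case False
        define s where "s = real i * (\<delta> / 2)"
        have s: "0 \<le> s" "s \<le> x" "x \<le> 1" "x - s < \<delta>"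
          using False x \<delta>(1) by (auto simp: s_def algebra_simps)
        hence "S s = 0" using Suc x by (auto simp: s_def)
        from step[OF s(1-3) this short[OF s]] show ?thesis .
      qed
    qed
  qed
  moreover obtain i where "x \<le> real i * (\<delta> / 2)"
    using reals_Archimedean3[of "\<delta> / 2"] \<delta>(1) by (meson half_gt_zero less_imp_le)
  ultimately have "S x = 0" using kx(2) by blast
  thus ?thesis using S0 kx(1) by blast
qed

section \<open>Quasi-derivatives\<close>

lemma differentiable_has_vector_derivative_iff:
  fixes f :: "real \<Rightarrow> complex"
  shows "f differentiable (at x) \<and> d = vector_derivative f (at x) - e \<longleftrightarrow>
    (f has_vector_derivative d + e) (at x)"
  by (metis add_diff_cancel_right' diff_add_cancel differentiableI_vector vector_derivative_at vector_derivative_works)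

text \<open>The recursion solved for the derivatives: a first-order linear system for the vector of
  quasi-derivatives.\<close>
lemma quasi_derivatives_F_matrix_iff:
  "quasi_derivatives (F_matrix \<tau>1 \<tau>2) y Y \<longleftrightarrow>
     Y 0 = y \<and> (\<forall>k\<in>{0..3}. abs_continuous_01 (Y k)) \<and>
     (AE x in lebesgue_on {0<..<1}.
        (Y 0 has_vector_derivative Y 1 x) (at x) \<and>
        (Y 1 has_vector_derivative Y 2 x - \<tau>2 x * Y 0 x + \<tau>1 x * Y 1 x) (at x) \<and>
        (Y 2 has_vector_derivative Y 3 x + \<tau>1 x * \<tau>2 x * Y 0 x
           + (2 * \<tau>2 x - (\<tau>1 x)\<^sup>2) * Y 1 x - \<tau>1 x * Y 2 x) (at x) \<and>
        (Y 3 has_vector_derivative Y 4 x + (\<tau>2 x)\<^sup>2 * Y 0 x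
           - \<tau>1 x * \<tau>2 x * Y 1 x - \<tau>2 x * Y 2 x) (at x))"
proof -
  have k: "{1..4} = {1, 2, 3, 4::nat}" by auto
  have sums: "{1..2} = {1, 2::nat}" "{1..3} = {1, 2, 3::nat}" by auto
  show ?thesis
    unfolding quasi_derivatives_def differentiable_has_vector_derivative_iff k ball_simps AE_conj_iff
    by (simp add: k sums F_matrix_def mat_of_rows_list_def AE_conj_iff algebra_simps flip: One_nat_def)
qed

lemma quasi_derivatives_linear:
  assumes Y: "quasi_derivatives F y Y" and Z: "quasi_derivatives F z Z"
  shows "quasi_derivatives F (\<lambda>x. a * y x + b * z x) (\<lambda>k x. a * Y k x + b * Z k x)"
  unfolding quasi_derivatives_def
proof (intro conjI ballI)
  show "(\<lambda>x. a * Y 0 x + b * Z 0 x) = (\<lambda>x. a * y x + b * z x)"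
    using Y Z by (simp add: quasi_derivatives_def)
next
  fix k :: nat assume "k \<in> {0..3}"
  thus "abs_continuous_01 (\<lambda>x. a * Y k x + b * Z k x)"
    using Y Z unfolding quasi_derivatives_def by (intro abs_continuous_01_linear_combination) auto
next
  fix k :: nat assume k: "k \<in> {1..4}"
  let ?s = "\<lambda>Y x. \<Sum>j=1..k. F x $$ (k - 1, j - 1) * Y (j - 1) x"
  have "AE x in lebesgue_on {0<..<1}. (Y (k - 1) has_vector_derivative Y k x + ?s Y x) (at x)"
    "AE x in lebesgue_on {0<..<1}. (Z (k - 1) has_vector_derivative Z k x + ?s Z x) (at x)"
    using Y Z k unfolding quasi_derivatives_def differentiable_has_vector_derivative_iff by blast+
  thus "AE x in lebesgue_on {0<..<1}. (\<lambda>x. a * Y (k - 1) x + b * Z (k - 1) x) differentiable at x \<and>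
      a * Y k x + b * Z k x = vector_derivative (\<lambda>x. a * Y (k - 1) x + b * Z (k - 1) x) (at x)
        - (\<Sum>j=1..k. F x $$ (k - 1, j - 1) * (a * Y (j - 1) x + b * Z (j - 1) x))"
    unfolding differentiable_has_vector_derivative_iff
  proof eventually_elim
    case (elim x)
    have "((\<lambda>x. a * Y (k - 1) x + b * Z (k - 1) x) has_vector_derivative
        a * (Y k x + ?s Y x) + b * (Z k x + ?s Z x)) (at x)"
      using elim by (intro has_vector_derivative_add has_vector_derivative_mult_right)
    moreover have "a * (Y k x + ?s Y x) + b * (Z k x + ?s Z x) = a * Y k x + b * Z k x
        + (\<Sum>j=1..k. F x $$ (k - 1, j - 1) * (a * Y (j - 1) x + b * Z (j - 1) x))"
      by (simp add: algebra_simps sum.distrib sum_distrib_left)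
    ultimately show ?case by simp
  qed
qed

text \<open>Quasi-derivatives are determined successively: once the lower ones vanish, the recursion makes
  the next one vanish almost everywhere, and for \<open>k \<le> 3\<close> continuity removes the exceptional set.\<close>
lemma quasi_derivatives_of_zero:
  assumes W: "quasi_derivatives F w W" and w: "\<And>x. x \<in> {0..1} \<Longrightarrow> w x = 0"
  shows "k \<le> 3 \<Longrightarrow> x \<in> {0..1} \<Longrightarrow> W k x = 0"
    and "k \<le> 4 \<Longrightarrow> AE x in lebesgue_on {0<..<1}. W k x = 0"
proof -
  have "(k \<le> 3 \<longrightarrow> (\<forall>x\<in>{0..1}. W k x = 0)) \<and> (k \<le> 4 \<longrightarrow> (AE x in lebesgue_on {0<..<1}. W k x = 0))" for k
  proof (induction k rule: less_induct)
    case (less k)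
    have ae: "AE x in lebesgue_on {0<..<1}. W k x = 0" if "k \<le> 4"
    proof (cases "k = 0")
      case True
      show ?thesis using W w True by (auto simp: quasi_derivatives_def intro!: AE_I2)
    next
      case False
      have prev: "W j x = 0" if "j < k" "x \<in> {0<..<1}" for j x
        using less.IH[of j] that \<open>k \<le> 4\<close> by auto
      have "AE x in lebesgue_on {0<..<1}. W (k - 1) differentiable (at x) \<and>
          W k x = vector_derivative (W (k - 1)) (at x) - (\<Sum>j=1..k. F x $$ (k - 1, j - 1) * W (j - 1) x)"
        using W False \<open>k \<le> 4\<close> by (auto simp: quasi_derivatives_def)
      moreover have "AE x in lebesgue_on {0<..<1}. x \<in> {0<..<1::real}" by (rule AE_I2) simp
      ultimately show ?thesis
      proof eventually_elim
        case (elim x)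
        have "((\<lambda>x. 0) has_vector_derivative 0) (at x)" by simp
        hence "(W (k - 1) has_vector_derivative 0) (at x)"
          by (rule has_vector_derivative_transform_within_open[where S = "{0<..<1}"])
            (use elim prev[of "k - 1"] False in auto)
        thus "W k x = 0" using elim prev by (auto simp: vector_derivative_at intro!: sum.neutral)
      qed
    qed
    moreover have "\<forall>x\<in>{0..1}. W k x = 0" if "k \<le> 3"
    proof -
      have "abs_continuous_01 (W k)" using W that by (simp add: quasi_derivatives_def)
      moreover have "AE x in lebesgue_on {0<..<1}. W k x = 0" using ae that by simp
      ultimately show ?thesis
        using continuous_AE_zero abs_continuous_01_imp_continuous_on by blast
    qed
    ultimately show ?case by blast
  qed
  thus "k \<le> 3 \<Longrightarrow> x \<in> {0..1} \<Longrightarrow> W k x = 0"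
    and "k \<le> 4 \<Longrightarrow> AE x in lebesgue_on {0<..<1}. W k x = 0" by blast+
qed

lemma quasi_derivatives_unique:
  assumes Y: "quasi_derivatives F y Y" and Z: "quasi_derivatives F y Z"
  shows "k \<le> 3 \<Longrightarrow> x \<in> {0..1} \<Longrightarrow> Y k x = Z k x"
    and "k \<le> 4 \<Longrightarrow> AE x in lebesgue_on {0<..<1}. Y k x = Z k x"
proof -
  have "quasi_derivatives F (\<lambda>x. 0) (\<lambda>k x. Y k x - Z k x)"
    using quasi_derivatives_linear[OF Y Z, of 1 "-1"] by simp
  note * = quasi_derivatives_of_zero[OF this]
  show "k \<le> 3 \<Longrightarrow> x \<in> {0..1} \<Longrightarrow> Y k x = Z k x" using *(1)[of k x] by simp
  show "k \<le> 4 \<Longrightarrow> AE x in lebesgue_on {0<..<1}. Y k x = Z k x" using *(2)[of k] by simp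
qed

text \<open>The entries of the coefficient matrix of the system, with \<open>y\<^bsup>[4]\<^esup> = lam y\<close> inserted, are at most
  quadratic in \<open>\<tau>1\<close> and \<open>\<tau>2\<close>, so square integrability provides the integrable bound that uniqueness
  for linear systems requires.\<close>
lemma solution_unique:
  assumes sq: "square_integrable \<tau>1" "square_integrable \<tau>2"
    and Y: "quasi_derivatives (F_matrix \<tau>1 \<tau>2) y Y"
    and eq: "AE x in lebesgue_on {0<..<1}. Y 4 x = lam * y x"
    and init: "\<And>k. k \<le> 3 \<Longrightarrow> Y k 0 = 0" and kx: "k \<le> 3" "x \<in> {0..1}"
  shows "Y k x = 0"
proof (rule linear_system_unique[where K = "{..3::nat}" and Y' = "\<lambda>k x. vector_derivative (Y k) (at x)"])
  let ?h = "\<lambda>x. cmod lam + 3 * (1 + (cmod (\<tau>1 x))\<^sup>2 + (cmod (\<tau>2 x))\<^sup>2)"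
  have "(\<lambda>x. (cmod (\<tau> x))\<^sup>2) integrable_on {0<..<1}" if "square_integrable \<tau>" for \<tau>
    using that by (auto simp: square_integrable_def intro!: integrable_on_lebesgue_on)
  hence "(\<lambda>x. (cmod (\<tau> x))\<^sup>2) integrable_on {0..1}" if "square_integrable \<tau>" for \<tau>
    using that by (metis integrable_on_Icc_iff_Ioo)
  thus "?h integrable_on {0..1}"
    using sq by (intro integrable_add integrable_on_mult_right integrable_const_ivl)
  show "0 \<le> ?h x" for x by simp
  have Y0: "Y 0 = y" and ac: "\<forall>k\<in>{0..3}. abs_continuous_01 (Y k)"
    using Y by (auto simp: quasi_derivatives_def)
  have S: "(\<Sum>j\<in>{..3::nat}. f j) = f 0 + f 1 + f 2 + f 3" for f :: "nat \<Rightarrow> real"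
    by (simp add: numeral_eq_Suc)
  show "abs_continuous_01 (Y k)" if "k \<in> {..3}" for k using ac that by auto
  have "AE x in lebesgue_on {0<..<1}.
        (Y 0 has_vector_derivative Y 1 x) (at x) \<and>
        (Y 1 has_vector_derivative Y 2 x - \<tau>2 x * Y 0 x + \<tau>1 x * Y 1 x) (at x) \<and>
        (Y 2 has_vector_derivative Y 3 x + \<tau>1 x * \<tau>2 x * Y 0 x
           + (2 * \<tau>2 x - (\<tau>1 x)\<^sup>2) * Y 1 x - \<tau>1 x * Y 2 x) (at x) \<and>
        (Y 3 has_vector_derivative Y 4 x + (\<tau>2 x)\<^sup>2 * Y 0 x
           - \<tau>1 x * \<tau>2 x * Y 1 x - \<tau>2 x * Y 2 x) (at x)"
    using iffD1[OF quasi_derivatives_F_matrix_iff Y] by (elim conjE)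
  thus "AE x in lebesgue_on {0<..<1}. \<forall>k\<in>{..3}.
      (Y k has_vector_derivative vector_derivative (Y k) (at x)) (at x) \<and>
      cmod (vector_derivative (Y k) (at x)) \<le> ?h x * (\<Sum>j\<in>{..3}. cmod (Y j x))"
    using eq
  proof eventually_elim
    case (elim x)
    define p q where "p = cmod (\<tau>1 x)" and "q = cmod (\<tau>2 x)"
    have comb: "cmod (a * Y 0 x + b * Y 1 x + c * Y 2 x + d * Y 3 x) \<le> ?h x * (\<Sum>j\<in>{..3}. cmod (Y j x))"
      if "cmod a \<le> ?h x" "cmod b \<le> ?h x" "cmod c \<le> ?h x" "cmod d \<le> ?h x" for a b c d
    proof -
      have "cmod (a * Y 0 x + b * Y 1 x + c * Y 2 x + d * Y 3 x)
          \<le> cmod a * cmod (Y 0 x) + cmod b * cmod (Y 1 x) + cmod c * cmod (Y 2 x) + cmod d * cmod (Y 3 x)"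
        by (intro norm_triangle_mono) (simp_all add: norm_mult)
      also have "\<dots> \<le> ?h x * cmod (Y 0 x) + ?h x * cmod (Y 1 x) + ?h x * cmod (Y 2 x) + ?h x * cmod (Y 3 x)"
        using that by (intro add_mono mult_right_mono) auto
      finally show ?thesis by (simp only: S distrib_left)
    qed
    \<comment> \<open>\<open>2 r \<le> 1 + r\<^sup>2\<close> and \<open>2 p q \<le> p\<^sup>2 + q\<^sup>2\<close> bring all coefficients below \<open>?h x\<close>.\<close>
    have sqs: "2 * p \<le> 1 + p\<^sup>2" "2 * q \<le> 1 + q\<^sup>2" "2 * (p * q) \<le> p\<^sup>2 + q\<^sup>2"
      using zero_le_power2[of "p - 1"] zero_le_power2[of "q - 1"] zero_le_power2[of "p - q"]
      by (simp_all add: power2_diff)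
    have pos: "0 \<le> p\<^sup>2" "0 \<le> q\<^sup>2" "0 \<le> p" "0 \<le> q" "0 \<le> cmod lam" "0 \<le> p * q" by (auto simp: p_def q_def)
    have h: "?h x = cmod lam + 3 * (1 + p\<^sup>2 + q\<^sup>2)" by (simp add: p_def q_def)
    have "1 \<le> ?h x" unfolding h using pos by argo
    moreover have "p \<le> ?h x" unfolding h using sqs pos by argo
    moreover have "q \<le> ?h x" unfolding h using sqs pos by argo
    moreover have "p * q \<le> ?h x" unfolding h using sqs pos by argo
    moreover have "0 \<le> ?h x" unfolding h using pos by argo
    ultimately have coeffs: "cmod 0 \<le> ?h x" "cmod 1 \<le> ?h x" "cmod (\<tau>1 x) \<le> ?h x" "cmod (- \<tau>1 x) \<le> ?h x"
      "cmod (- \<tau>2 x) \<le> ?h x" "cmod (\<tau>1 x * \<tau>2 x) \<le> ?h x" "cmod (- (\<tau>1 x * \<tau>2 x)) \<le> ?h x"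
      by (simp_all only: norm_minus_cancel norm_mult p_def q_def norm_zero norm_one)
    have "cmod (2 * \<tau>2 x - (\<tau>1 x)\<^sup>2) \<le> 2 * q + p\<^sup>2"
      using norm_triangle_ineq4[of "2 * \<tau>2 x" "(\<tau>1 x)\<^sup>2"] by (simp add: p_def q_def norm_mult norm_power)
    hence c1: "cmod (2 * \<tau>2 x - (\<tau>1 x)\<^sup>2) \<le> ?h x" using sqs pos unfolding h by argo
    have "cmod (lam + (\<tau>2 x)\<^sup>2) \<le> cmod lam + q\<^sup>2"
      using norm_triangle_ineq[of lam "(\<tau>2 x)\<^sup>2"] by (simp add: q_def norm_power)
    hence c2: "cmod (lam + (\<tau>2 x)\<^sup>2) \<le> ?h x" using sqs pos unfolding h by argo
    have Y4: "Y 4 x = lam * Y 0 x" using elim Y0 by simp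
    show ?case
    proof
      fix k :: nat assume "k \<in> {..3}"
      then consider "k = 0" | "k = 1" | "k = 2" | "k = 3" by fastforce
      then obtain a b c d where "cmod a \<le> ?h x" "cmod b \<le> ?h x" "cmod c \<le> ?h x" "cmod d \<le> ?h x"
        "(Y k has_vector_derivative a * Y 0 x + b * Y 1 x + c * Y 2 x + d * Y 3 x) (at x)"
      proof cases
        case 1
        show ?thesis by (rule that[of 0 1 0 0]) (use elim coeffs 1 in simp_all)
      next
        case 2
        show ?thesis
          by (rule that[of "- \<tau>2 x" "\<tau>1 x" 1 0]) (use elim coeffs 2 in \<open>simp_all add: algebra_simps\<close>)
      next
        case 3
        show ?thesis
          by (rule that[of "\<tau>1 x * \<tau>2 x" "2 * \<tau>2 x - (\<tau>1 x)\<^sup>2" "- \<tau>1 x" 1])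
            (use elim coeffs c1 3 in \<open>simp_all add: algebra_simps\<close>)
      next
        case 4
        show ?thesis
          by (rule that[of "lam + (\<tau>2 x)\<^sup>2" "- (\<tau>1 x * \<tau>2 x)" "- \<tau>2 x" 0])
            (use elim coeffs c2 4 in \<open>simp_all add: Y4[unfolded Y0] Y0 algebra_simps\<close>)
      qed
      thus "(Y k has_vector_derivative vector_derivative (Y k) (at x)) (at x) \<and>
          cmod (vector_derivative (Y k) (at x)) \<le> ?h x * (\<Sum>j\<in>{..3}. cmod (Y j x))"
        using comb by (simp add: vector_derivative_at)
    qed
  qed
qed (use init kx in auto)

section \<open>Adding a linear function to the second coefficient\<close>

text \<open>These are the quasi-derivatives of \<open>y\<close> after \<open>c x\<close> is added to \<open>\<tau>2\<close>, expressed by the old ones. They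
  follow from the recursion: \<open>y\<^bsup>[2]\<^esup>\<close> contains \<open>\<tau>2 y\<close>, which gives the term \<open>c x y\<close>, and in \<open>y\<^bsup>[3]\<^esup>\<close> the
  derivative of \<open>c x y\<close> and the term \<open>-2 c x y'\<close> add up to \<open>c y - c x y'\<close>, whereas the terms
  with \<open>\<tau>1\<close> cancel.\<close>
definition shifted_quasi_derivatives ::
  "complex \<Rightarrow> (nat \<Rightarrow> real \<Rightarrow> complex) \<Rightarrow> nat \<Rightarrow> real \<Rightarrow> complex" where
  "shifted_quasi_derivatives c Y =
     Y(2 := (\<lambda>x. Y 2 x + c * of_real x * Y 0 x),
       3 := (\<lambda>x. Y 3 x + c * Y 0 x - c * of_real x * Y 1 x))"

lemma shifted_quasi_derivatives_simps [simp]: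
  "shifted_quasi_derivatives c Y 0 = Y 0"
  "shifted_quasi_derivatives c Y (Suc 0) = Y 1"
  "shifted_quasi_derivatives c Y 2 = (\<lambda>x. Y 2 x + c * of_real x * Y 0 x)"
  "shifted_quasi_derivatives c Y 3 = (\<lambda>x. Y 3 x + c * Y 0 x - c * of_real x * Y 1 x)"
  "shifted_quasi_derivatives c Y 4 = Y 4"
  by (simp_all add: shifted_quasi_derivatives_def)

text \<open>All contributions of \<open>c\<close> to \<open>y\<^bsup>[4]\<^esup>\<close> cancel. This is the invariance of \<open>l(y)\<close> under a change of
  \<open>\<tau>2\<close> by a linear function, whose second distributional derivative is zero.\<close>
lemma quasi_derivatives_shift:
  assumes Y: "quasi_derivatives (F_matrix \<sigma>1 \<sigma>2) y Y"
    and \<tau>1: "AE x in lebesgue_on {0<..<1}. \<tau>1 x = \<sigma>1 x"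
    and \<tau>2: "AE x in lebesgue_on {0<..<1}. \<tau>2 x = \<sigma>2 x + c * of_real x"
  shows "quasi_derivatives (F_matrix \<tau>1 \<tau>2) y (shifted_quasi_derivatives c Y)"
proof -
  let ?Z = "shifted_quasi_derivatives c Y"
  have Y0: "Y 0 = y" and ac: "\<And>k. k \<le> 3 \<Longrightarrow> abs_continuous_01 (Y k)"
    and Yd: "AE x in lebesgue_on {0<..<1}.
        (Y 0 has_vector_derivative Y 1 x) (at x) \<and>
        (Y 1 has_vector_derivative Y 2 x - \<sigma>2 x * Y 0 x + \<sigma>1 x * Y 1 x) (at x) \<and>
        (Y 2 has_vector_derivative Y 3 x + \<sigma>1 x * \<sigma>2 x * Y 0 x
           + (2 * \<sigma>2 x - (\<sigma>1 x)\<^sup>2) * Y 1 x - \<sigma>1 x * Y 2 x) (at x) \<and>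
        (Y 3 has_vector_derivative Y 4 x + (\<sigma>2 x)\<^sup>2 * Y 0 x
           - \<sigma>1 x * \<sigma>2 x * Y 1 x - \<sigma>2 x * Y 2 x) (at x)"
    using iffD1[OF quasi_derivatives_F_matrix_iff Y] by (auto simp del: AE_conj_iff)
  \<comment> \<open>The new functions are absolutely continuous because \<open>x y\<^bsup>[0]\<^esup>\<close> and \<open>x y\<^bsup>[1]\<^esup>\<close> are.\<close>
  have acx: "abs_continuous_01 (\<lambda>x. of_real x * Y k x)" if "k \<le> 3" for k
    by (intro abs_continuous_01_mult abs_continuous_01_of_real ac that)
  have ac2: "abs_continuous_01 (?Z 2)"
    using abs_continuous_01_linear_combination[OF ac[of 2] acx[of 0], of 1 c]
    by (simp add: mult.assoc)
  have ac3: "abs_continuous_01 (?Z 3)"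
    using abs_continuous_01_linear_combination
      [OF abs_continuous_01_linear_combination[OF ac[of 3] ac[of 0], of 1 c] acx[of 1], of 1 "- c"]
    by (simp add: mult.assoc)
  have ZAC: "abs_continuous_01 (?Z k)" if "k \<in> {0..3}" for k
  proof -
    have "k = 0 \<or> k = 1 \<or> k = 2 \<or> k = 3" using that unfolding atLeastAtMost_iff by presburger
    thus ?thesis using ac[of 0] ac[of 1] ac2 ac3 by (elim disjE) simp_all
  qed
  have "AE x in lebesgue_on {0<..<1}.
        (?Z 0 has_vector_derivative ?Z 1 x) (at x) \<and>
        (?Z 1 has_vector_derivative ?Z 2 x - \<tau>2 x * ?Z 0 x + \<tau>1 x * ?Z 1 x) (at x) \<and>
        (?Z 2 has_vector_derivative ?Z 3 x + \<tau>1 x * \<tau>2 x * ?Z 0 x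
           + (2 * \<tau>2 x - (\<tau>1 x)\<^sup>2) * ?Z 1 x - \<tau>1 x * ?Z 2 x) (at x) \<and>
        (?Z 3 has_vector_derivative ?Z 4 x + (\<tau>2 x)\<^sup>2 * ?Z 0 x
           - \<tau>1 x * \<tau>2 x * ?Z 1 x - \<tau>2 x * ?Z 2 x) (at x)"
    using Yd \<tau>1 \<tau>2
  proof eventually_elim
    case (elim x)
    let ?d1 = "Y 2 x - \<sigma>2 x * Y 0 x + \<sigma>1 x * Y 1 x"
    let ?d2 = "Y 3 x + \<sigma>1 x * \<sigma>2 x * Y 0 x + (2 * \<sigma>2 x - (\<sigma>1 x)\<^sup>2) * Y 1 x - \<sigma>1 x * Y 2 x"
    let ?d3 = "Y 4 x + (\<sigma>2 x)\<^sup>2 * Y 0 x - \<sigma>1 x * \<sigma>2 x * Y 1 x - \<sigma>2 x * Y 2 x"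
    have d0: "(Y 0 has_vector_derivative Y 1 x) (at x)" and d1: "(Y 1 has_vector_derivative ?d1) (at x)"
      and d2: "(Y 2 has_vector_derivative ?d2) (at x)" and d3: "(Y 3 has_vector_derivative ?d3) (at x)"
      using elim by auto
    have lin: "((\<lambda>x. c * of_real x) has_vector_derivative c) (at x)"
      using has_vector_derivative_mult_right[OF has_vector_derivative_of_real[OF DERIV_ident], of c]
      by simp
    have e2: "(?Z 2 has_vector_derivative ?d2 + (c * of_real x * Y 1 x + c * Y 0 x)) (at x)"
      unfolding shifted_quasi_derivatives_simps
      by (rule has_vector_derivative_add[OF d2 has_vector_derivative_mult[OF lin d0]])
    have e3: "(?Z 3 has_vector_derivative ?d3 + c * Y 1 x - (c * of_real x * ?d1 + c * Y 1 x)) (at x)"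
      unfolding shifted_quasi_derivatives_simps
      by (rule has_vector_derivative_diff[OF has_vector_derivative_add[OF d3
            has_vector_derivative_mult_right[OF d0]] has_vector_derivative_mult[OF lin d1]])
    have t: "\<tau>1 x = \<sigma>1 x" "\<tau>2 x = \<sigma>2 x + c * of_real x" using elim by auto
    show ?case
    proof (intro conjI)
      show "(?Z 0 has_vector_derivative ?Z 1 x) (at x)" using d0 by simp
      show "(?Z 1 has_vector_derivative ?Z 2 x - \<tau>2 x * ?Z 0 x + \<tau>1 x * ?Z 1 x) (at x)"
        using d1 by (simp add: t algebra_simps)
      show "(?Z 2 has_vector_derivative ?Z 3 x + \<tau>1 x * \<tau>2 x * ?Z 0 x
           + (2 * \<tau>2 x - (\<tau>1 x)\<^sup>2) * ?Z 1 x - \<tau>1 x * ?Z 2 x) (at x)"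
        by (rule has_vector_derivative_eq_rhs[OF e2]) (simp add: t algebra_simps)
      show "(?Z 3 has_vector_derivative ?Z 4 x + (\<tau>2 x)\<^sup>2 * ?Z 0 x
           - \<tau>1 x * \<tau>2 x * ?Z 1 x - \<tau>2 x * ?Z 2 x) (at x)"
        by (rule has_vector_derivative_eq_rhs[OF e3]) (simp add: t algebra_simps power2_eq_square)
    qed
  qed
  moreover have "?Z 0 = y" using Y0 by simp
  ultimately show ?thesis unfolding quasi_derivatives_F_matrix_iff using ZAC by blast
qed

lemma quasi_derivatives_quasi_deriv:
  assumes "y \<in> dom_F F"
  shows "quasi_derivatives F y (quasi_deriv F y)"
  using assms someI_ex[of "quasi_derivatives F y"] by (simp add: dom_F_def quasi_deriv_def)

text \<open>The relation between two problems is symmetric up to the sign of \<open>c\<close>, so each transfer from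
  \<open>F'\<close> to \<open>F\<close> proved in this locale can also be used in the opposite direction.\<close>
locale shifted_coefficients =
  fixes \<tau>1 \<tau>2 \<tau>1' \<tau>2' :: "real \<Rightarrow> complex" and c :: complex and F F' :: "real \<Rightarrow> complex Matrix.mat"
  assumes F_def: "F = F_matrix \<tau>1 \<tau>2" and F'_def: "F' = F_matrix \<tau>1' \<tau>2'"
    and \<tau>1_eq: "AE x in lebesgue_on {0<..<1}. \<tau>1 x = \<tau>1' x"
    and \<tau>2_eq: "AE x in lebesgue_on {0<..<1}. \<tau>2 x = \<tau>2' x + c * of_real x"
begin

lemma swap: "shifted_coefficients \<tau>1' \<tau>2' \<tau>1 \<tau>2 (- c) F' F"
proof
  show "AE x in lebesgue_on {0<..<1}. \<tau>1' x = \<tau>1 x" using \<tau>1_eq by eventually_elim simp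
  show "AE x in lebesgue_on {0<..<1}. \<tau>2' x = \<tau>2 x + - c * of_real x"
    using \<tau>2_eq by eventually_elim simp
qed (fact F_def F'_def)+

lemma is_solution_shift:
  assumes "is_solution F' lam y"
  shows "is_solution F lam y"
    and "k \<le> 3 \<Longrightarrow> x \<in> {0..1} \<Longrightarrow>
      quasi_deriv F y k x = shifted_quasi_derivatives c (quasi_deriv F' y) k x"
proof -
  have y: "y \<in> dom_F F'" "AE x in lebesgue_on {0<..<1}. quasi_deriv F' y 4 x = lam * y x"
    using assms by (auto simp: is_solution_def)
  have Z: "quasi_derivatives F y (shifted_quasi_derivatives c (quasi_deriv F' y))"
    unfolding F_def using quasi_derivatives_quasi_deriv[OF y(1)] \<tau>1_eq \<tau>2_eq
    unfolding F'_def by (rule quasi_derivatives_shift)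
  hence dom: "y \<in> dom_F F" by (auto simp: dom_F_def)
  note Y = quasi_derivatives_quasi_deriv[OF dom]
  show "k \<le> 3 \<Longrightarrow> x \<in> {0..1} \<Longrightarrow>
      quasi_deriv F y k x = shifted_quasi_derivatives c (quasi_deriv F' y) k x"
    by (rule quasi_derivatives_unique(1)[OF Y Z])
  have "AE x in lebesgue_on {0<..<1}. quasi_deriv F y 4 x = quasi_deriv F' y 4 x"
    using quasi_derivatives_unique(2)[OF Y Z, of 4] by simp
  hence "AE x in lebesgue_on {0<..<1}. quasi_deriv F y 4 x = lam * y x"
    using y(2) by eventually_elim simp
  thus "is_solution F lam y" using dom by (simp add: is_solution_def)
qed

text \<open>The terms with the factor \<open>x\<close> vanish at \<open>0\<close>, so among the forms at \<open>0\<close> only \<open>U\<^sub>4\<close> is affected,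
  through the term \<open>c y\<close> of \<open>y\<^bsup>[3]\<^esup>\<close>; at \<open>1\<close> the term \<open>c x y\<close> of \<open>y\<^bsup>[2]\<^esup>\<close> enters \<open>V\<^sub>3\<close>.\<close>
lemma forms_shift:
  assumes "is_solution F' lam y"
  shows "s \<in> {1, 2, 3} \<Longrightarrow> U_form F s y = U_form F' s y"
    and "U_form F 4 y = U_form F' 4 y + c * U_form F' 1 y"
    and "V_form F 4 y = V_form F' 4 y"
    and "V_form F 3 y = V_form F' 3 y + c * V_form F' 4 y"
  using is_solution_shift(2)[OF assms, of 0] is_solution_shift(2)[OF assms, of 1]
    is_solution_shift(2)[OF assms, of 2] is_solution_shift(2)[OF assms, of 3]
  by (auto simp: U_form_def V_form_def)

lemma is_eigenvalue_shift:
  assumes "is_eigenvalue F' i j lam" "i \<in> {1, 2, 3}" "j \<in> {1, 2, 3}"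
  shows "is_eigenvalue F i j lam"
proof -
  obtain y where y: "is_solution F' lam y" "\<exists>x\<in>{0..1}. y x \<noteq> 0" "U_form F' i y = 0" "U_form F' j y = 0"
      "V_form F' 3 y = 0" "V_form F' 4 y = 0"
    using assms(1) unfolding is_eigenvalue_def by blast
  show ?thesis
    unfolding is_eigenvalue_def
    using y is_solution_shift(1)[OF y(1)] forms_shift[OF y(1)] assms(2,3) by (intro exI[of _ y]) simp
qed

text \<open>The only initial value that changes is \<open>U\<^sub>4\<close>, by \<open>c U\<^sub>1\<close>. Hence \<open>C'\<^sub>1\<close> has the initial data of
  \<open>C\<^sub>1 + c C\<^sub>4\<close> with respect to \<open>F\<close>, while the other \<open>C'\<^sub>k\<close> have those of \<open>C\<^sub>k\<close>, and uniqueness for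
  the initial value problem identifies them.\<close>
lemma cauchy_solutions_shift:
  assumes sq: "square_integrable \<tau>1" "square_integrable \<tau>2"
    and C: "cauchy_solutions F C" and C': "cauchy_solutions F' C'"
    and k: "k \<in> {1..4}" and s: "s \<in> {3, 4}"
  shows "V_form F s (C k lam) = V_form F s (C' k lam) - (if k = 1 then c else 0) * V_form F s (C 4 lam)"
proof -
  define e where "e = (if k = 1 then c else 0)"
  have sol: "is_solution F lam (C k lam)" "is_solution F' lam (C' k lam)" "is_solution F lam (C 4 lam)"
    using C C' k by (auto simp: cauchy_solutions_def)
  have sol': "is_solution F lam (C' k lam)" using is_solution_shift(1)[OF sol(2)] .
  let ?Y = "quasi_deriv F (C k lam)" and ?Y' = "quasi_deriv F (C' k lam)" and ?Y4 = "quasi_deriv F (C 4 lam)"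
  \<comment> \<open>The shape of \<open>?D\<close> is that of a nested linear combination as produced by
    \<open>quasi_derivatives_linear\<close>; it is the difference \<open>C\<^sub>k - C'\<^sub>k + e C\<^sub>4\<close>.\<close>
  let ?D = "\<lambda>j x. 1 * (1 * ?Y j x + (- 1) * ?Y' j x) + e * ?Y4 j x"
  have Y: "quasi_derivatives F (C k lam) ?Y" "quasi_derivatives F (C' k lam) ?Y'" "quasi_derivatives F (C 4 lam) ?Y4"
    using sol sol' by (auto simp: is_solution_def intro: quasi_derivatives_quasi_deriv)
  have D: "quasi_derivatives F (\<lambda>x. 1 * (1 * C k lam x + (- 1) * C' k lam x) + e * C 4 lam x) ?D"
    by (intro quasi_derivatives_linear Y)
  have "AE x in lebesgue_on {0<..<1}. ?Y 4 x = lam * C k lam x"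
    "AE x in lebesgue_on {0<..<1}. ?Y' 4 x = lam * C' k lam x"
    "AE x in lebesgue_on {0<..<1}. ?Y4 4 x = lam * C 4 lam x"
    using sol sol' by (auto simp: is_solution_def)
  hence D4: "AE x in lebesgue_on {0<..<1}. ?D 4 x = lam * (1 * (1 * C k lam x + (- 1) * C' k lam x) + e * C 4 lam x)"
    by eventually_elim (simp add: algebra_simps)
  have U: "U_form F s (C k lam) = (if s = k then 1 else 0)" "U_form F' s (C' k lam) = (if s = k then 1 else 0)"
    "U_form F s (C 4 lam) = (if s = 4 then 1 else 0)" if "s \<in> {1..4}" for s
    using C C' k that by (auto simp: cauchy_solutions_def)
  have U': "U_form F s (C' k lam) = (if s = k then 1 else 0) + (if s = 4 then e else 0)" if "s \<in> {1..4}" for s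
  proof -
    have "s \<in> {1, 2, 3} \<or> s = 4" using that by auto
    thus ?thesis using forms_shift(1,2)[OF sol(2)] U(2) by (elim disjE) (auto simp: e_def)
  qed
  have D0: "?D j 0 = 0" if "j \<le> 3" for j
    using U(1)[of "Suc j"] U'[of "Suc j"] U(3)[of "Suc j"] that by (simp add: U_form_def)
  have "?D j 1 = 0" if "j \<le> 3" for j
    using solution_unique[OF sq D[unfolded F_def] D4[unfolded F_def]] D0 that by (simp add: F_def)
  from this[of 0] this[of 2] show ?thesis
    using s by (auto simp: V_form_def e_def algebra_simps)
qed

text \<open>Two elementary operations leave the determinant invariant: passing from \<open>F'\<close> to \<open>F\<close> adds a
  multiple of the row of \<open>V\<^sub>4\<close> to that of \<open>V\<^sub>3\<close>, and, if \<open>a = 1\<close>, it subtracts a multiple of the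
  column of \<open>C\<^sub>4\<close> from that of \<open>C\<^sub>1\<close>. This is where it matters that \<open>4\<close> is always one of the two
  column indices.\<close>
lemma V_det_shift:
  assumes sq: "square_integrable \<tau>1" "square_integrable \<tau>2"
    and C: "cauchy_solutions F C" and C': "cauchy_solutions F' C'"
    and a: "a \<in> {1..3}"
  shows "V_det F C [3, 4] [a, 4] = V_det F' C' [3, 4] [a, 4]"
proof
  fix lam
  have det: "Determinant.det (Matrix.mat 2 2 f) = f (0, 0) * f (1, 1) - f (0, 1) * f (1, 0)"
    for f :: "nat \<times> nat \<Rightarrow> complex"
    by (subst laplace_expansion_row[where n = 2 and i = 0])
      (simp_all add: cofactor_def mat_delete_def det_single numeral_2_eq_2)
  have sol: "is_solution F' lam (C' a lam)" "is_solution F' lam (C' 4 lam)"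
    using C' a by (auto simp: cauchy_solutions_def)
  define e where "e = (if a = 1 then c else 0)"
  note shift = cauchy_solutions_shift[OF sq C C']
  have col_a: "V_form F s (C a lam) = V_form F s (C' a lam) - e * V_form F s (C' 4 lam)" if "s \<in> {3, 4}" for s
    using shift[OF _ that, of a] shift[OF _ that, of 4] a by (simp add: e_def)
  have col_4: "V_form F s (C 4 lam) = V_form F s (C' 4 lam)" if "s \<in> {3, 4}" for s
    using shift[OF _ that, of 4] by simp
  show "V_det F C [3, 4] [a, 4] lam = V_det F' C' [3, 4] [a, 4] lam"
    unfolding V_det_def
    by (simp add: det numeral_2_eq_2[symmetric] col_a col_4 forms_shift(3,4)[OF sol(1)]
        forms_shift(3,4)[OF sol(2)] algebra_simps)
qed

end

theorem theorem2p3: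
  fixes \<tau>1 \<tau>2 \<tau>1' \<tau>2' :: "real \<Rightarrow> complex"
    and C C' :: "nat \<Rightarrow> complex \<Rightarrow> real \<Rightarrow> complex"
    and F F' :: "real \<Rightarrow> complex Matrix.mat"
    and c :: complex
  assumes "square_integrable \<tau>1" and "square_integrable \<tau>2"
    and "square_integrable \<tau>1'" and "square_integrable \<tau>2'"
    and "F = F_matrix \<tau>1 \<tau>2" and "F' = F_matrix \<tau>1' \<tau>2'"
    and "cauchy_solutions F C" and "cauchy_solutions F' C'"
    and "class_W F C" and "class_W F' C'"
    and "AE x in lebesgue_on {0<..<1}. \<tau>1 x = \<tau>1' x"
    and "AE x in lebesgue_on {0<..<1}. \<tau>2 x = \<tau>2' x + c * of_real x"
  shows "spectrum_S F C 1 2 = spectrum_S F' C' 1 2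
       \<and> spectrum_S F C 1 3 = spectrum_S F' C' 1 3
       \<and> spectrum_S F C 2 3 = spectrum_S F' C' 2 3"
proof -
  interpret shifted_coefficients \<tau>1 \<tau>2 \<tau>1' \<tau>2' c F F'
    using assms by unfold_locales
  interpret swapped: shifted_coefficients \<tau>1' \<tau>2' \<tau>1 \<tau>2 "- c" F' F
    by (rule swap)
  have eigen: "is_eigenvalue F i j lam \<longleftrightarrow> is_eigenvalue F' i j lam"
    if "i \<in> {1, 2, 3}" "j \<in> {1, 2, 3}" for i j lam
    using is_eigenvalue_shift swapped.is_eigenvalue_shift that by blast
  have ab: "{1, 2, 3, 4} - {1, 2} = {3, 4::nat}" "{1, 2, 3, 4} - {1, 3} = {2, 4::nat}"
    "{1, 2, 3, 4} - {2, 3} = {1, 4::nat}" by auto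
  have sorted: "sorted_list_of_set {a, 4} = [a, 4]" if "a \<in> {1..3}" for a :: nat
    using that by simp
  note det = V_det_shift[OF assms(1,2,7,8)]
  show ?thesis
    unfolding spectrum_S_def ab by (simp add: eigen sorted det)
qed

end
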